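(* Let $d>1$ be an integer, let $\mathbf{B}$ be a closed ball of radius $r>0$ in $\mathbb{E}^d$, and for $1\leq i\leq n$ let $\mathbf{C}_i$ be an $r_i$-ball body in $\mathbb{E}^d$ with $0<r_i\leq r$, such that $\mathbf{B}\subseteq\bigcup_{i=1}^{n}\mathbf{C}_i$. Then $$r\leq\sum_{i=1}^{n}r_{in}(\mathbf{C}_i\cap\mathbf{B}).$$
   Context: $\mathbb{E}^d$ is $d$-dimensional Euclidean space and $\mathbf{B}^d[\mathbf{p},s]$ is the closed ball of radius $s$ centered at $\mathbf{p}$. For $s>0$, an $s$-ball body is a set of the form $X^s:=\bigcap_{\mathbf{x}\in X}\mathbf{B}^d[\mathbf{x},s]$ with $\emptyset\neq X\subseteq\mathbb{E}^d$. For a convex body $\mathbf{K}$ (compact convex set with nonempty interior), the inradius $r_{in}(\mathbf{K})$ is the radius of the largest ball contained in $\mathbf{K}$; for a compact convex set with empty interior (including the empty set) the inradius is taken to be $0$. *)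

theory Defs
  imports "HOL-Analysis.Analysis"
begin

definition ball_body :: "real \<Rightarrow> 'a::euclidean_space set \<Rightarrow> bool" where
  "ball_body s C \<longleftrightarrow> s > 0 \<and> (\<exists>X. X \<noteq> {} \<and> C = (\<Inter>x\<in>X. cball x s))"

(* Intended for compact convex K. For compact K with nonempty interior the supremum is attained,
   see inradius_attained and inradius_upper below. *)
definition inradius :: "'a::euclidean_space set \<Rightarrow> real" where
  "inradius K = (if interior K = {} then 0 else Sup {s. s > 0 \<and> (\<exists>p. cball p s \<subseteq> K)})"

lemma bdd_above_inball_radii:
  fixes K :: "'a::euclidean_space set"
  assumes "bounded K"
  shows "bdd_above {s. s > 0 \<and> (\<exists>p. cball p s \<subseteq> K)}"
proof (rule bdd_aboveI)
  fix s assume "s \<in> {s. s > 0 \<and> (\<exists>p. cball p s \<subseteq> K)}"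
  then obtain p where s: "s > 0" "cball p s \<subseteq> K" by auto
  have "diameter (cball p s) \<le> diameter K"
    using s assms by (intro diameter_subset)
  then show "s \<le> diameter K" using s(1) by (simp add: diameter_cball)
qed

lemma inradius_upper:
  fixes K :: "'a::euclidean_space set"
  assumes "bounded K" "s > 0" "cball p s \<subseteq> K"
  shows "s \<le> inradius K"
proof -
  have "p \<in> interior K"
    using assms(2,3) unfolding mem_interior_cball by blast
  then have "inradius K = Sup {s. s > 0 \<and> (\<exists>p. cball p s \<subseteq> K)}"
    by (auto simp: inradius_def)
  then show ?thesis
    using assms bdd_above_inball_radii[OF assms(1)] by (auto intro!: cSup_upper)
qed

lemma inradius_attained:
  fixes K :: "'a::euclidean_space set"
  assumes K: "compact K" and int: "interior K \<noteq> {}"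
  shows "inradius K > 0 \<and> (\<exists>p. cball p (inradius K) \<subseteq> K)"
proof -
  let ?S = "{s. s > 0 \<and> (\<exists>p. cball p s \<subseteq> K)}"
  have R: "inradius K = Sup ?S" using int by (simp add: inradius_def)
  obtain q e where qe: "e > 0" "cball q e \<subseteq> K"
    using int unfolding ex_in_conv[symmetric] mem_interior_cball by blast
  have pos: "inradius K > 0"
    using inradius_upper[OF compact_imp_bounded[OF K] qe] qe(1) by linarith
  have "\<exists>s\<in>?S. inradius K - inverse (real (Suc n)) < s" for n
  proof -
    have "inradius K - inverse (real (Suc n)) < Sup ?S" unfolding R by simp
    moreover have "?S \<noteq> {}" using qe by auto
    ultimately show ?thesis
      by (rule less_cSupD[rotated])
  qed
  then have "\<forall>n. \<exists>s p. s > 0 \<and> cball p s \<subseteq> K \<and> inradius K - inverse (real (Suc n)) < s"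
    by blast
  then obtain s p where sp: "\<And>n. s n > 0" "\<And>n. cball (p n) (s n) \<subseteq> K"
      "\<And>n. inradius K - inverse (real (Suc n)) < s n"
    by metis
  have "\<forall>n. p n \<in> K" proof
    fix n show "p n \<in> K" using sp(1)[of n] sp(2)[of n] by (intro subsetD[OF sp(2)[of n]]) simp
  qed
  then obtain l f where l: "l \<in> K" "strict_mono (f :: nat \<Rightarrow> nat)" "(p \<circ> f) \<longlonglongrightarrow> l"
    using K unfolding compact_def by blast
  have "ball l (inradius K) \<subseteq> K"
  proof
    fix x assume "x \<in> ball l (inradius K)"
    then have d: "dist l x < inradius K" by simp
    have "(\<lambda>n. s (f n) - dist (p (f n)) x) \<longlonglongrightarrow> inradius K - dist l x"
    proof (rule tendsto_diff)
      show "(\<lambda>n. dist (p (f n)) x) \<longlonglongrightarrow> dist l x"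
        using l(3) by (auto intro!: tendsto_dist simp: o_def)
      have "s \<longlonglongrightarrow> inradius K"
      proof (rule tendsto_sandwich)
        show "\<forall>\<^sub>F n in sequentially. inradius K - inverse (real (Suc n)) \<le> s n"
          by (rule always_eventually) (intro allI less_imp_le sp(3))
        show "\<forall>\<^sub>F n in sequentially. s n \<le> inradius K"
          using inradius_upper[OF compact_imp_bounded[OF K] sp(1,2)] by simp
        show "(\<lambda>n. inradius K - inverse (real (Suc n))) \<longlonglongrightarrow> inradius K"
          using tendsto_diff[OF tendsto_const LIMSEQ_inverse_real_of_nat] by simp
      qed simp
      then show "(\<lambda>n. s (f n)) \<longlonglongrightarrow> inradius K"
        using LIMSEQ_subseq_LIMSEQ[OF _ l(2)] by (auto simp: o_def)
    qed
    then have "\<forall>\<^sub>F n in sequentially. s (f n) - dist (p (f n)) x > 0"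
      using d by (intro order_tendstoD(1)) auto
    then obtain n where "dist (p (f n)) x < s (f n)"
      by (auto simp: eventually_sequentially)
    then show "x \<in> K" using sp(2)[of "f n"] by auto
  qed
  then have "cball l (inradius K) \<subseteq> K"
    using pos closure_minimal[OF _ compact_imp_closed[OF K]] closure_ball[OF pos] by metis
  then show ?thesis using pos by blast
qed

end

theory Submission imports Defs begin

text \<open>
  The proof is a version of Bang's argument for the plank problem. Since \<open>\<rho> i \<le> r\<close>, every
  ball of radius \<open>\<rho> i\<close> is an intersection of balls of radius \<open>r\<close>, so that \<open>C i \<inter> B\<close>
  is an intersection of balls of radius \<open>r\<close>, with a set of centres \<open>A\<close> say. It contains a ball
  of radius \<open>s\<close> exactly if \<open>A\<close> lies in some ball of radius \<open>r - s\<close>. Hence if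
  \<open>s\<close> exceeds the inradius, then already finitely many of the centres have a smallest enclosing
  ball, with centre \<open>z\<close> and radius \<open>R\<close> say, for which \<open>R + s > r\<close>. The centres at distance
  \<open>R\<close> from \<open>z\<close> have \<open>z\<close> in their convex hull; written as \<open>z - R u\<close> they give unit vectors \<open>u\<close>
  with \<open>0\<close> in their convex hull, and a point \<open>p\<close> with \<open>(p - z) \<bullet> u \<ge> s\<close> is at distance at
  least \<open>R + s > r\<close> from \<open>z - R u\<close>, so it is missed by \<open>C i \<inter> B\<close> (lemma
  \<open>ball_intersection_misses_halfspaces\<close>).

  Now suppose that the inradii add up to less than \<open>r\<close>. Then the numbers \<open>s i\<close> can be chosen
  above the inradii with sum at most \<open>r\<close>, and every point \<open>c + (\<Sum>i. s i u i)\<close> with unit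
  vectors \<open>u i\<close> is in \<open>B\<close>. Choosing the \<open>u i\<close> among the vectors above so as to maximise a suitable
  quadratic function gives a point that lies in one of the missed half-spaces of
  every \<open>C i \<inter> B\<close> (lemma \<open>bang_choice\<close>), so the sets \<open>C i\<close> do not cover \<open>B\<close>.
\<close>

text \<open>
  The maximised function is \<open>|T|\<^sup>2 - 2 (\<Sum>i. s i (u i \<bullet> z i))\<close> with \<open>T = (\<Sum>i. s i u i)\<close>, as in
  Bang's lemma, where each \<open>U i\<close> consists of two opposite vectors. Optimality against
  replacing a single \<open>u i\<close> by \<open>v\<close> says that \<open>u i\<close> maximises the functional
  \<open>v \<mapsto> (T - z i - s i u i) \<bullet> v\<close> on \<open>U i\<close>; the maximum is nonnegative because \<open>0\<close> is in the
  convex hull of \<open>U i\<close>, and this is the claim.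
\<close>
lemma bang_choice:
  fixes U :: "'i \<Rightarrow> 'a::euclidean_space set" and z :: "'i \<Rightarrow> 'a" and s :: "'i \<Rightarrow> real"
  assumes I: "finite I"
    and s: "\<And>i. i \<in> I \<Longrightarrow> s i > 0"
    and U: "\<And>i. i \<in> I \<Longrightarrow> finite (U i)" "\<And>i. i \<in> I \<Longrightarrow> U i \<subseteq> sphere 0 1"
      "\<And>i. i \<in> I \<Longrightarrow> 0 \<in> convex hull (U i)"
  shows "\<exists>u\<in>Pi\<^sub>E I U. \<forall>i\<in>I. s i \<le> ((\<Sum>j\<in>I. s j *\<^sub>R u j) - z i) \<bullet> u i"
proof -
  define T :: "('i \<Rightarrow> 'a) \<Rightarrow> 'a" where "T u = (\<Sum>j\<in>I. s j *\<^sub>R u j)" for u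
  define L :: "('i \<Rightarrow> 'a) \<Rightarrow> real" where "L u = (\<Sum>j\<in>I. s j * (u j \<bullet> z j))" for u
  define F where "F u = (norm (T u))\<^sup>2 - 2 * L u" for u
  have fin: "finite (Pi\<^sub>E I U)"
    using I U(1) by (rule finite_PiE)
  have "U i \<noteq> {}" if "i \<in> I" for i
    using U(3)[OF that] by auto
  then have "Pi\<^sub>E I U \<noteq> {}"
    by (simp add: PiE_eq_empty_iff)
  then obtain u where u: "u \<in> Pi\<^sub>E I U" and max: "\<And>v. v \<in> Pi\<^sub>E I U \<Longrightarrow> F v \<le> F u"
    using ex_is_arg_min_if_finite[OF fin, of "\<lambda>u. - F u"] by (auto simp: is_arg_min_linorder)
  have "s i \<le> (T u - z i) \<bullet> u i" if i: "i \<in> I" for i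
  proof -
    let ?w = "T u - z i - s i *\<^sub>R u i"
    have unit: "v \<bullet> v = 1" if "v \<in> U i" for v
      using U(2)[OF i] that by (auto simp: dot_square_norm)
    have ui: "u i \<in> U i"
      using u i by auto
    have le: "?w \<bullet> v \<le> ?w \<bullet> u i" if v: "v \<in> U i" for v
    proof -
      let ?u' = "u(i := v)"
      have rest: "(\<Sum>j\<in>I - {i}. g j (?u' j)) = (\<Sum>j\<in>I - {i}. g j (u j))"
        for g :: "'i \<Rightarrow> 'a \<Rightarrow> 'b::comm_monoid_add"
        by (intro sum.cong) auto
      have T': "T ?u' = T u + s i *\<^sub>R (v - u i)"
        using rest[of "\<lambda>j x. s j *\<^sub>R x"] unfolding T_def sum.remove[OF I i]
        by (simp add: algebra_simps)
      have L': "L ?u' = L u + s i * ((v - u i) \<bullet> z i)"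
        using rest[of "\<lambda>j x. s j * (x \<bullet> z j)"] unfolding L_def sum.remove[OF I i]
        by (simp add: algebra_simps inner_diff_left)
      have "?u' \<in> Pi\<^sub>E I U"
        using u v i by (auto simp: PiE_iff extensional_def)
      then have "F ?u' - F u \<le> 0"
        using max[of ?u'] by simp
      also have "F ?u' - F u = 2 * s i * (?w \<bullet> v - ?w \<bullet> u i)"
        unfolding F_def T' L' power2_norm_eq_inner using unit[OF v] unit[OF ui]
        by (simp add: inner_add_left inner_add_right inner_diff_left inner_diff_right
            inner_commute algebra_simps)
      finally show ?thesis
        using s[OF i] by (simp add: mult_le_0_iff)
    qed
    have "convex hull (U i) \<subseteq> {x. ?w \<bullet> x \<le> ?w \<bullet> u i}"
      using le by (intro hull_minimal) (auto simp: convex_halfspace_le)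
    then have "0 \<le> ?w \<bullet> u i"
      using U(3)[OF i] by auto
    then show ?thesis
      using unit[OF ui] by (simp add: inner_diff_left)
  qed
  then show ?thesis
    using u unfolding T_def by blast
qed

text \<open>
  A smallest enclosing ball has its centre in the convex hull of the points on
  its boundary: otherwise a hyperplane separates the centre from these points, and a small move of
  the centre towards them brings all points of the set closer than the radius.
\<close>
lemma smallest_enclosing_ball:
  fixes A :: "'a::euclidean_space set"
  assumes A: "finite A" "A \<noteq> {}"
  obtains z R where "A \<subseteq> cball z R" "z \<in> convex hull (A \<inter> sphere z R)"
proof -
  define f where "f x = Max ((\<lambda>a. dist x a) ` A)" for x
  have f_ge: "dist x a \<le> f x" if "a \<in> A" for x a
    unfolding f_def using A that by simp
  have f_less: "f x < t" if "\<And>a. a \<in> A \<Longrightarrow> dist x a < t" for x t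
    unfolding f_def using A that by simp
  have cont: "continuous_on UNIV f"
    unfolding continuous_on_iff
  proof (intro ballI allI impI)
    fix x :: 'a and e :: real
    assume e: "e > 0"
    have "f y < f x + e" if "dist y x < e" for x y
    proof (rule f_less)
      fix a assume "a \<in> A"
      then show "dist y a < f x + e"
        using that f_ge[of a x] dist_triangle[of y a x] by linarith
    qed
    then have "dist (f y) (f x) < e" if "dist y x < e" for y
      using that by (metis abs_diff_less_iff dist_commute dist_real_def less_diff_eq
          diff_less_eq add.commute)
    then show "\<exists>d>0. \<forall>x'\<in>UNIV. dist x' x < d \<longrightarrow> dist (f x') (f x) < e"
      using e by blast
  qed
  obtain a0 where a0: "a0 \<in> A"
    using A by blast
  \<comment> \<open>Outside this ball \<open>f\<close> exceeds its value at \<open>a0\<close>.\<close>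
  let ?K = "cball a0 (f a0)"
  have f0: "0 \<le> f a0"
    using f_ge[OF a0, of a0] by simp
  then obtain z where z: "z \<in> ?K" "\<And>x. x \<in> ?K \<Longrightarrow> f z \<le> f x"
    using continuous_attains_inf[of ?K f] continuous_on_subset[OF cont] by auto
  have min: "f z \<le> f x" for x
  proof (cases "x \<in> ?K")
    case False
    then have "f a0 < f x"
      using f_ge[OF a0, of x] by (simp add: dist_commute)
    then show ?thesis
      using z(2)[of a0] f0 by simp
  qed (rule z)
  let ?S = "A \<inter> sphere z (f z)"
  have "z \<in> convex hull ?S"
  proof (rule ccontr)
    assume "z \<notin> convex hull ?S"
    moreover have "compact (convex hull ?S)"
      using A by (simp add: finite_imp_compact_convex_hull)
    ultimately obtain w b where wb: "w \<bullet> z < b" "\<And>x. x \<in> convex hull ?S \<Longrightarrow> b < w \<bullet> x"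
      using separating_hyperplane_closed_point[of "convex hull ?S" z]
      by (auto simp: compact_imp_closed)
    have "\<forall>\<^sub>F t in at_right 0. dist (z + t *\<^sub>R w) a < f z" if a: "a \<in> A" for a
    proof (cases "dist z a = f z")
      case True
      then have "a \<in> convex hull ?S"
        using a by (intro hull_inc) simp
      then have pos: "w \<bullet> (a - z) > 0"
        using wb by (force simp: inner_diff_right)
      have "((\<lambda>t::real. t * (w \<bullet> w)) \<longlongrightarrow> 0 * (w \<bullet> w)) (at_right 0)"
        by (intro tendsto_intros)
      then have "\<forall>\<^sub>F t in at_right 0. t * (w \<bullet> w) < 2 * (w \<bullet> (a - z))"
        using pos by (intro order_tendstoD(2)) auto
      then show ?thesis
        using eventually_at_right_less[of "0::real"]
      proof eventually_elim
        case (elim t)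
        have "(dist (z + t *\<^sub>R w) a)\<^sup>2
            = (dist z a)\<^sup>2 + t * (t * (w \<bullet> w) - 2 * (w \<bullet> (a - z)))"
          unfolding dist_norm power2_norm_eq_inner
          by (simp add: inner_add_left inner_add_right inner_diff_left inner_diff_right
              inner_commute algebra_simps)
        also have "\<dots> < (f z)\<^sup>2"
          using elim True by (simp add: mult_less_0_iff)
        finally show ?case
          using True by (metis power2_less_imp_less zero_le_dist)
      qed
    next
      case False
      then have "dist z a < f z"
        using f_ge[OF a, of z] by simp
      moreover have "((\<lambda>t. dist (z + t *\<^sub>R w) a) \<longlongrightarrow> dist (z + 0 *\<^sub>R w) a) (at_right 0)"
        by (intro tendsto_intros)
      ultimately show ?thesis
        by (intro order_tendstoD(2)) auto
    qed
    then have "\<forall>\<^sub>F t in at_right 0. \<forall>a\<in>A. dist (z + t *\<^sub>R w) a < f z"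
      using A by (simp add: eventually_ball_finite)
    then obtain t where "\<forall>a\<in>A. dist (z + t *\<^sub>R w) a < f z"
      using eventually_happens'[OF trivial_limit_at_right_real] by blast
    then have "f (z + t *\<^sub>R w) < f z"
      by (intro f_less) blast
    then show False
      using min[of "z + t *\<^sub>R w"] by simp
  qed
  moreover have "A \<subseteq> cball z (f z)"
    using f_ge by auto
  ultimately show ?thesis
    using that by blast
qed

text \<open>
  A ball of radius \<open>s\<close> about \<open>p\<close> lies in all balls of radius \<open>r\<close> centred in \<open>A\<close> as soon as \<open>p\<close> is
  within \<open>r - s\<close> of every point of \<open>A\<close>. Under the hypothesis there is no such \<open>p\<close>, and by
  compactness a finite subset of \<open>A\<close> already excludes it. The vectors in \<open>U\<close> point from the points
  of that subset on the boundary of its smallest enclosing ball to the centre \<open>z\<close>.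
\<close>
lemma ball_intersection_misses_halfspaces:
  fixes A :: "'a::euclidean_space set"
  assumes s: "s \<le> r"
    and no_ball: "\<And>p. \<not> cball p s \<subseteq> (\<Inter>a\<in>A. cball a r)"
  obtains U z where "finite U" "U \<subseteq> sphere 0 1" "0 \<in> convex hull U"
    "\<And>u p. u \<in> U \<Longrightarrow> s \<le> (p - z) \<bullet> u \<Longrightarrow> p \<notin> (\<Inter>a\<in>A. cball a r)"
proof -
  have "A \<noteq> {}"
    using no_ball by fastforce
  then obtain a0 where a0: "a0 \<in> A"
    by blast
  have "\<exists>F. finite F \<and> F \<subseteq> A \<and> (\<Inter>a\<in>F. cball a (r - s)) = {}"
  proof (rule ccontr)
    assume none: "\<nexists>F. finite F \<and> F \<subseteq> A \<and> (\<Inter>a\<in>F. cball a (r - s)) = {}"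
    have "cball a0 (r - s) \<inter> (\<Inter>a\<in>F. cball a (r - s)) \<noteq> {}"
      if "finite F" "F \<subseteq> A" for F
    proof -
      have "(\<Inter>a\<in>insert a0 F. cball a (r - s)) \<noteq> {}"
        using none that a0 by (meson finite.insertI insert_subsetI)
      then show ?thesis
        by (simp only: INF_insert not_False_eq_True)
    qed
    then have "cball a0 (r - s) \<inter> (\<Inter>a\<in>A. cball a (r - s)) \<noteq> {}"
      by (rule compact_imp_fip_image[OF compact_cball closed_cball])
    then obtain p where "p \<in> (\<Inter>a\<in>A. cball a (r - s))"
      by blast
    then have p: "\<And>a. a \<in> A \<Longrightarrow> dist a p \<le> r - s"
      by simp
    have "cball p s \<subseteq> (\<Inter>a\<in>A. cball a r)"
    proof (intro subsetI INT_I)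
      fix q a assume "q \<in> cball p s" "a \<in> A"
      then show "q \<in> cball a r"
        using p[of a] dist_triangle[of a q p] by simp
    qed
    then show False
      using no_ball by blast
  qed
  then obtain F where F: "finite F" "F \<subseteq> A" "(\<Inter>a\<in>F. cball a (r - s)) = {}"
    by blast
  then have "F \<noteq> {}"
    by auto
  then obtain z R where zR: "F \<subseteq> cball z R" "z \<in> convex hull (F \<inter> sphere z R)"
    using smallest_enclosing_ball[OF F(1)] by blast
  have R: "r - s < R"
  proof (rule ccontr)
    assume "\<not> r - s < R"
    then have "z \<in> (\<Inter>a\<in>F. cball a (r - s))"
      using zR(1) by (force simp: dist_commute)
    then show False
      using F(3) by blast
  qed
  then have Rpos: "R > 0"
    using s by simp
  define h where "h a = (1 / R) *\<^sub>R z + (- 1 / R) *\<^sub>R a" for a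
  have h: "h a = (1 / R) *\<^sub>R (z - a)" for a
    by (simp add: h_def algebra_simps)
  define U where "U = h ` (F \<inter> sphere z R)"
  have "convex hull U = h ` (convex hull (F \<inter> sphere z R))"
    unfolding U_def h_def by (rule convex_hull_affinity)
  moreover have "h z = 0"
    by (simp add: h)
  ultimately have "0 \<in> convex hull U"
    using zR(2) by (metis image_eqI)
  moreover have unit: "U \<subseteq> sphere 0 1"
    using Rpos by (auto simp: U_def h dist_norm)
  moreover have "p \<notin> (\<Inter>a\<in>A. cball a r)" if u: "u \<in> U" and p: "s \<le> (p - z) \<bullet> u" for u p
  proof -
    obtain a where a: "a \<in> F" "u = h a"
      using u by (auto simp: U_def)
    then have eq: "p - a = p - z + R *\<^sub>R u"
      using Rpos by (simp add: h)
    have nu: "norm u = 1"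
      using u unit by auto
    then have "u \<bullet> u = 1"
      by (simp add: dot_square_norm)
    then have "s + R \<le> (p - a) \<bullet> u"
      using p by (simp add: eq inner_add_left)
    also have "\<dots> \<le> norm (p - a)"
      using norm_cauchy_schwarz[of "p - a" u] nu by simp
    finally have "r < dist a p"
      using R by (simp add: dist_norm norm_minus_commute)
    then show ?thesis
      using a F(2) by force
  qed
  moreover have "finite U"
    using F(1) by (simp add: U_def)
  ultimately show ?thesis
    using that by blast
qed

text \<open>
  A point \<open>p\<close> outside the small ball is also outside the large ball that contains the small one
  and touches it at the boundary point nearest to \<open>p\<close>.
\<close>
lemma cball_eq_Inter_larger_cballs:
  fixes x :: "'a::euclidean_space"
  assumes "0 \<le> s" "s \<le> r"
  shows "cball x s = (\<Inter>y\<in>cball x (r - s). cball y r)"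
proof (intro equalityI subsetI)
  fix p assume p: "p \<in> cball x s"
  show "p \<in> (\<Inter>y\<in>cball x (r - s). cball y r)"
  proof
    fix y assume "y \<in> cball x (r - s)"
    then show "p \<in> cball y r"
      using p dist_triangle[of y p x] by (simp add: dist_commute)
  qed
next
  fix p assume p: "p \<in> (\<Inter>y\<in>cball x (r - s). cball y r)"
  show "p \<in> cball x s"
  proof (cases "p = x")
    case False
    define y where "y = x + ((r - s) / norm (x - p)) *\<^sub>R (x - p)"
    have "dist x y = r - s"
      using assms False by (simp add: y_def dist_norm)
    then have "dist y p \<le> r"
      using p by auto
    also have "y - p = (1 + (r - s) / norm (x - p)) *\<^sub>R (x - p)"
      by (simp add: y_def algebra_simps)
    then have "dist y p = (1 + (r - s) / norm (x - p)) * norm (x - p)"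
      using assms by (simp add: dist_norm)
    also have "\<dots> = norm (x - p) + (r - s)"
      using False by (simp add: field_simps)
    finally show ?thesis
      by (simp add: dist_norm)
  qed (use assms in simp)
qed

lemma ball_body_Int_cball:
  fixes C :: "'a::euclidean_space set"
  assumes "ball_body s C" "s \<le> r"
  obtains A where "C \<inter> cball c r = (\<Inter>a\<in>A. cball a r)"
proof -
  obtain X where X: "s > 0" "C = (\<Inter>x\<in>X. cball x s)"
    using assms(1) by (auto simp: ball_body_def)
  have "C = (\<Inter>x\<in>X. \<Inter>y\<in>cball x (r - s). cball y r)"
    unfolding X(2) using X(1) assms(2) by (intro INF_cong refl cball_eq_Inter_larger_cballs) auto
  then have "C \<inter> cball c r = (\<Inter>a\<in>insert c (\<Union>x\<in>X. cball x (r - s)). cball a r)"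
    by auto
  then show ?thesis
    by (rule that)
qed

lemma inradius_nonneg:
  fixes K :: "'a::euclidean_space set"
  assumes "compact K"
  shows "0 \<le> inradius K"
  using inradius_attained[OF assms] by (cases "interior K = {}") (auto simp: inradius_def)

theorem corollary3:
  fixes B :: "'a::euclidean_space set" and C :: "nat \<Rightarrow> 'a set"
    and c :: 'a and r :: real and \<rho> :: "nat \<Rightarrow> real" and n :: nat
  assumes "DIM('a) > 1"
    and "r > 0" and "B = cball c r"
    and "\<And>i. i \<in> {1..n} \<Longrightarrow> 0 < \<rho> i \<and> \<rho> i \<le> r \<and> ball_body (\<rho> i) (C i)"
    and "B \<subseteq> (\<Union>i\<in>{1..n}. C i)"
  shows "r \<le> (\<Sum>i=1..n. inradius (C i \<inter> B))"
proof (rule ccontr)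
  assume less: "\<not> r \<le> (\<Sum>i=1..n. inradius (C i \<inter> B))"
  have "n \<noteq> 0"
    using assms(2,3,5) by (cases n) auto
  define e where "e = (r - (\<Sum>i=1..n. inradius (C i \<inter> B))) / n"
  have e: "e > 0"
    using less \<open>n \<noteq> 0\<close> by (simp add: e_def)
  define s where "s i = inradius (C i \<inter> B) + e" for i
  have sum_s: "(\<Sum>i=1..n. s i) = r"
    using \<open>n \<noteq> 0\<close> by (simp add: s_def sum.distrib e_def)
  have "\<exists>A. C i \<inter> B = (\<Inter>a\<in>A. cball a r)" if "i \<in> {1..n}" for i
    using assms(4)[OF that] ball_body_Int_cball[of "\<rho> i" "C i" r c] assms(3) by metis
  then obtain A where A: "\<And>i. i \<in> {1..n} \<Longrightarrow> C i \<inter> B = (\<Inter>a\<in>A i. cball a r)"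
    by metis
  have comp: "compact (C i \<inter> B)" if "i \<in> {1..n}" for i
  proof -
    have "closed (C i)"
      using assms(4)[OF that] by (auto simp: ball_body_def)
    then show ?thesis
      using assms(3) by (simp add: closed_Int_compact)
  qed
  have s_pos: "s i > 0" if "i \<in> {1..n}" for i
    using inradius_nonneg[OF comp[OF that]] e by (simp add: s_def)
  have "s i \<le> r" if "i \<in> {1..n}" for i
    using member_le_sum[of i "{1..n}" s] that s_pos sum_s by (simp add: less_imp_le)
  moreover have "\<not> cball p (s i) \<subseteq> (\<Inter>a\<in>A i. cball a r)" if i: "i \<in> {1..n}" for i p
    using inradius_upper[OF compact_imp_bounded[OF comp[OF i]] s_pos[OF i], of p] e
    unfolding A[OF i, symmetric] by (auto simp: s_def)
  ultimately have "\<exists>U z. finite U \<and> U \<subseteq> sphere 0 1 \<and> 0 \<in> convex hull U \<and>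
      (\<forall>u\<in>U. \<forall>p. s i \<le> (p - z) \<bullet> u \<longrightarrow> p \<notin> (\<Inter>a\<in>A i. cball a r))" if "i \<in> {1..n}" for i
    by (metis that ball_intersection_misses_halfspaces)
  then obtain U z where U: "\<And>i. i \<in> {1..n} \<Longrightarrow> finite (U i)"
      "\<And>i. i \<in> {1..n} \<Longrightarrow> U i \<subseteq> sphere 0 1" "\<And>i. i \<in> {1..n} \<Longrightarrow> 0 \<in> convex hull (U i)"
    and miss: "\<And>i u p. i \<in> {1..n} \<Longrightarrow> u \<in> U i \<Longrightarrow> s i \<le> (p - z i) \<bullet> u \<Longrightarrow> p \<notin> C i \<inter> B"
    using A by metis
  obtain u where u: "u \<in> Pi\<^sub>E {1..n} U"
    "\<forall>i\<in>{1..n}. s i \<le> ((\<Sum>j\<in>{1..n}. s j *\<^sub>R u j) - (z i - c)) \<bullet> u i"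
    using bang_choice[of "{1..n}" s U "\<lambda>i. z i - c"] s_pos U by auto
  define p where "p = c + (\<Sum>j=1..n. s j *\<^sub>R u j)"
  have norm_u: "norm (u i) = 1" if "i \<in> {1..n}" for i
    using PiE_mem[OF u(1) that] U(2)[OF that] by auto
  have "p \<notin> C i \<inter> B" if i: "i \<in> {1..n}" for i
  proof (rule miss[OF i PiE_mem[OF u(1) i]])
    show "s i \<le> (p - z i) \<bullet> u i"
      using u(2) i by (simp add: p_def algebra_simps)
  qed
  moreover have "p \<in> B"
  proof -
    have "norm (\<Sum>j=1..n. s j *\<^sub>R u j) \<le> (\<Sum>j=1..n. s j)"
      using norm_u s_pos by (intro sum_norm_le) (simp add: abs_of_pos)
    then show ?thesis
      using sum_s assms(3) by (simp add: p_def dist_norm)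
  qed
  ultimately show False
    using assms(5) by blast
qed

end
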